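(* Let $\mathcal{H}$ be a real Hilbert space, let $L>0$, $\mu\in[0,L[$ and $\rho\ge 0$ be such that $\mu+\rho>0$. Let $f\colon\mathcal{H}\to\mathbb{R}$ be a differentiable $\mu$-strongly convex function such that $\nabla f$ is $L$-Lipschitz continuous, and let $h\colon\mathcal{H}\to\left]-\infty,+\infty\right]$ be proper, lower semicontinuous and $\rho$-strongly convex. Set $F=f+h$ and let $x^*$ be the unique minimizer of $F$ over $\mathcal{H}$. Let $x_0$ and $y_0$ be in $\mathcal{H}$, set $$\gamma=\frac{1}{L}\quad\text{and}\quad \alpha=\frac{\sqrt{L+\rho}-\sqrt{\mu+\rho}}{\sqrt{L+\rho}+\sqrt{\mu+\rho}},$$ and let $(x_k)_{k\in\mathbb{N}}$ and $(y_k)_{k\in\mathbb{N}}$ be generated by $$(\forall k\in\mathbb{N})\quad \begin{cases} x_{k+1}=\mathrm{prox}_{\gamma h}(y_k-\gamma\nabla f(y_k))\\ y_{k+1}=x_{k+1}+\alpha(x_{k+1}-x_k).\end{cases}$$ Set $$(\forall k\in\mathbb{N})\quad z_k=x_k+\frac{\sqrt{L+\rho}+\sqrt{\mu+\rho}}{\sqrt{\mu+\rho}}\,(y_k-x_k)$$ and $$\Phi_{\mu,\rho}\colon(x,z)\mapsto F(x)-F(x^* )+\frac{\mu+\rho}{2}\|z-x^*\|^2.$$ Then $$(\forall k\in\mathbb{N})\quad \Phi_{\mu,\rho}(x_{k+1},z_{k+1})\le r(\mu,\rho,L)\,\Phi_{\mu,\rho}(x_k,z_k),$$ where $$r(\m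u,\rho,L)=1-\sqrt{\frac{\mu+\rho}{L+\rho}}.$$
   Context: Conventions: for $\sigma\ge 0$, a function $\varphi\colon\mathcal{H}\to\left]-\infty,+\infty\right]$ is $\sigma$-strongly convex if $\varphi-\frac{\sigma}{2}\|\cdot\|^2$ is convex (so $0$-strongly convex means convex). For a proper lower semicontinuous convex function $\varphi$, the proximity operator is $\mathrm{prox}_{\varphi}(x)=\arg\min_{y\in\mathcal{H}}\varphi(y)+\frac12\|y-x\|^2$. $\mathbb{N}$ contains $0$, and $F$ may take the value $+\infty$. *)

theory Defs
  imports "HOL-Analysis.Analysis"
begin

text \<open>
  A real Hilbert space is a type of sort \<open>{real_inner, complete_space}\<close>. Functions with values in
  \<open>]-\<infinity>, +\<infinity>]\<close> are rendered as functions into \<^typ>\<open>ereal\<close>; that the value \<open>-\<infinity>\<close> is not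
  attained is part of \<open>proper\<close>.
\<close>

text \<open>
  The weight \<open>t\<close> ranges over the open interval, so that a product of 0 and \<open>+\<infinity>\<close> never occurs.
\<close>
definition ereal_convex :: "('a::real_vector \<Rightarrow> ereal) \<Rightarrow> bool" where
  "ereal_convex \<phi> \<longleftrightarrow>
     (\<forall>x y. \<forall>t\<in>{0<..<1::real}.
        \<phi> ((1 - t) *\<^sub>R x + t *\<^sub>R y) \<le> ereal (1 - t) * \<phi> x + ereal t * \<phi> y)"

definition strongly_convex :: "real \<Rightarrow> ('a::real_inner \<Rightarrow> ereal) \<Rightarrow> bool" where
  "strongly_convex \<sigma> \<phi> \<longleftrightarrow> ereal_convex (\<lambda>x. \<phi> x - ereal (\<sigma> / 2 * (norm x)\<^sup>2))"

definition proper :: "('a \<Rightarrow> ereal) \<Rightarrow> bool" where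
  "proper \<phi> \<longleftrightarrow> (\<forall>x. \<phi> x \<noteq> -\<infinity>) \<and> (\<exists>x. \<phi> x \<noteq> \<infinity>)"

definition lower_semicontinuous :: "('a::topological_space \<Rightarrow> ereal) \<Rightarrow> bool" where
  "lower_semicontinuous \<phi> \<longleftrightarrow> (\<forall>x. \<phi> x \<le> Liminf (nhds x) \<phi>)"

text \<open>
  For a proper lower semicontinuous convex function on a Hilbert space the minimizer exists and is
  unique, so the choice made by \<^const>\<open>arg_min\<close> is the proximal point; otherwise \<open>prox\<close> may be
  an arbitrary value.
\<close>
definition prox :: "('a::real_inner \<Rightarrow> ereal) \<Rightarrow> 'a \<Rightarrow> 'a" where
  "prox \<phi> x = arg_min (\<lambda>y. \<phi> y + ereal (1 / 2 * (norm (y - x))\<^sup>2)) (\<lambda>_. True)"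

lemma strongly_convex_real_iff:
  fixes f :: "'a::real_inner \<Rightarrow> real"
  shows "strongly_convex \<sigma> (\<lambda>x. ereal (f x)) \<longleftrightarrow>
    convex_on UNIV (\<lambda>x. f x - \<sigma> / 2 * (norm x)\<^sup>2)" (is "?L \<longleftrightarrow> ?R")
proof
  assume ?L
  then show ?R
    by (intro convex_onI) (auto simp: strongly_convex_def ereal_convex_def)
next
  assume R: ?R
  then show ?L
    using convex_onD[OF R] by (auto simp: strongly_convex_def ereal_convex_def)
qed

end

theory Submission
  imports Defs
begin

text \<open>
  Put \<open>q = sqrt ((\<mu> + \<rho>) / (L + \<rho>))\<close>. The step from \<open>x\<^sub>k\<close> to \<open>x\<^sub>k\<^sub>+\<^sub>1\<close> is a proximal gradient step
  taken at \<open>y\<^sub>k\<close>, and such a step produces a point \<open>p\<close> that satisfies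

    \<open>F(p) + (L + \<rho>)/2 |u - p|^2 \<le> F(u) + (L - \<mu>)/2 |u - y|^2\<close>

  for every \<open>u\<close> (\<open>proximal_gradient_inequality\<close>). This is the sum of three estimates:
  the quadratic growth of the prox objective around its minimizer, the quadratic upper bound on \<open>f\<close>
  given by the Lipschitz gradient, and the quadratic lower bound given by strong convexity.

  The rate comes from one choice of test point, \<open>u = (1 - q) x\<^sub>k + q x*\<close>. On the one hand, the
  parameters of the algorithm are such that \<open>x\<^sub>k\<^sub>+\<^sub>1 = (1 - q) x\<^sub>k + q z\<^sub>k\<^sub>+\<^sub>1\<close>, so that \<open>u - x\<^sub>k\<^sub>+\<^sub>1\<close> is
  \<open>q (x* - z\<^sub>k\<^sub>+\<^sub>1)\<close> and the left side is exactly the new value of \<open>\<Phi>\<close> (up to \<open>F(x*)\<close>),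
  because \<open>(L + \<rho>) q^2 = \<mu> + \<rho>\<close>. On the other hand, \<open>(\<mu> + \<rho>)\<close>-strong convexity of \<open>F\<close> bounds \<open>F(u)\<close>
  by \<open>(1 - q) F(x\<^sub>k) + q F(x*)\<close> minus \<open>(\<mu> + \<rho>)/2 q (1 - q) |x\<^sub>k - x*|^2\<close>; since
  \<open>(1 + q) y\<^sub>k = x\<^sub>k + q z\<^sub>k\<close>, that negative term absorbs what
  \<open>(L - \<mu>)/2 |u - y\<^sub>k|^2\<close> contributes beyond \<open>(1 - q) (\<mu> + \<rho>)/2 |z\<^sub>k - x*|^2\<close>
  (\<open>extrapolation_distance_bound\<close>).

  The minimizers \<open>x*\<close> and \<open>prox\<close> are given by \<open>arg_min\<close>, which has a meaning only once a minimizer is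
  known to exist. Both objectives are proper, lower semicontinuous and strongly convex with positive
  modulus, so a minimizing sequence is Cauchy (\<open>strongly_convex_has_minimizer\<close>).
\<close>

section \<open>Strong convexity as an inequality between finite values\<close>

text \<open>
  The squared norm satisfies the \<open>2\<close>-strong convexity inequality with equality. Hence adding or
  removing a multiple of it changes the quadratic gain in that inequality by an explicit amount.
\<close>
lemma norm_combination_sq:
  fixes x y :: "'a::real_inner"
  shows "(norm ((1 - t) *\<^sub>R x + t *\<^sub>R y))\<^sup>2 =
    (1 - t) * (norm x)\<^sup>2 + t * (norm y)\<^sup>2 - t * (1 - t) * (norm (x - y))\<^sup>2"
  unfolding power2_norm_eq_inner
  by (simp add: inner_add inner_diff inner_commute[of y x] algebra_simps power2_eq_square)

text \<open>
  Trading the subtracted square norm for a quadratic gain leaves an inequality between real numbers: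
  where an end point has value \<open>\<infinity>\<close> the inequality is void. Sums, multiples and
  consequences of strongly convex functions are handled in this form.
\<close>
lemma strongly_convex_iff_finite_values:
  fixes \<phi> :: "'a::real_inner \<Rightarrow> ereal"
  assumes "\<And>x. \<phi> x \<noteq> -\<infinity>"
  shows "strongly_convex \<sigma> \<phi> \<longleftrightarrow>
    (\<forall>x y a b. \<forall>t\<in>{0<..<1}. \<phi> x = ereal a \<longrightarrow> \<phi> y = ereal b \<longrightarrow>
       \<phi> ((1 - t) *\<^sub>R x + t *\<^sub>R y)
         \<le> ereal ((1 - t) * a + t * b - \<sigma> / 2 * (t * (1 - t) * (norm (x - y))\<^sup>2)))"
    (is "?L \<longleftrightarrow> ?R")
proof
  assume ?L
  show ?R
  proof (intro allI ballI impI)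
    fix x y a b and t :: real
    assume t: "t \<in> {0<..<1}" and "\<phi> x = ereal a" "\<phi> y = ereal b"
    moreover from \<open>?L\<close> t have "\<phi> ((1 - t) *\<^sub>R x + t *\<^sub>R y)
        - ereal (\<sigma> / 2 * (norm ((1 - t) *\<^sub>R x + t *\<^sub>R y))\<^sup>2)
        \<le> ereal (1 - t) * (\<phi> x - ereal (\<sigma> / 2 * (norm x)\<^sup>2))
          + ereal t * (\<phi> y - ereal (\<sigma> / 2 * (norm y)\<^sup>2))"
      unfolding strongly_convex_def ereal_convex_def by blast
    ultimately have "\<phi> ((1 - t) *\<^sub>R x + t *\<^sub>R y)
        - ereal (\<sigma> / 2 * (norm ((1 - t) *\<^sub>R x + t *\<^sub>R y))\<^sup>2)
        \<le> ereal ((1 - t) * (a - \<sigma> / 2 * (norm x)\<^sup>2) + t * (b - \<sigma> / 2 * (norm y)\<^sup>2))"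
      by simp
    then show "\<phi> ((1 - t) *\<^sub>R x + t *\<^sub>R y)
        \<le> ereal ((1 - t) * a + t * b - \<sigma> / 2 * (t * (1 - t) * (norm (x - y))\<^sup>2))"
      unfolding norm_combination_sq
      by (cases "\<phi> ((1 - t) *\<^sub>R x + t *\<^sub>R y)") (auto simp: field_simps)
  qed
next
  assume R: ?R
  show ?L
    unfolding strongly_convex_def ereal_convex_def
  proof (intro allI ballI)
    fix x y :: 'a and t :: real
    assume t: "t \<in> {0<..<1}"
    let ?w = "(1 - t) *\<^sub>R x + t *\<^sub>R y"
    show "\<phi> ?w - ereal (\<sigma> / 2 * (norm ?w)\<^sup>2)
      \<le> ereal (1 - t) * (\<phi> x - ereal (\<sigma> / 2 * (norm x)\<^sup>2))
        + ereal t * (\<phi> y - ereal (\<sigma> / 2 * (norm y)\<^sup>2))"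
    proof (cases "\<phi> x = \<infinity> \<or> \<phi> y = \<infinity>")
      case True
      then show ?thesis
        using t assms[of x] assms[of y] by (cases "\<phi> x"; cases "\<phi> y") auto
    next
      case False
      then obtain a b where ab: "\<phi> x = ereal a" "\<phi> y = ereal b"
        using assms by (metis ereal_cases)
      with R t have "\<phi> ?w
          \<le> ereal ((1 - t) * a + t * b - \<sigma> / 2 * (t * (1 - t) * (norm (x - y))\<^sup>2))"
        by blast
      then show ?thesis
        unfolding norm_combination_sq ab
        by (cases "\<phi> ?w") (auto simp: field_simps)
    qed
  qed
qed

lemma strongly_convexD:
  fixes \<phi> :: "'a::real_inner \<Rightarrow> ereal"
  assumes "strongly_convex \<sigma> \<phi>" and "\<And>x. \<phi> x \<noteq> -\<infinity>"
    and "\<phi> x = ereal a" and "\<phi> y = ereal b" and "0 < t" and "t < 1"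
  shows "\<phi> ((1 - t) *\<^sub>R x + t *\<^sub>R y)
     \<le> ereal ((1 - t) * a + t * b - \<sigma> / 2 * (t * (1 - t) * (norm (x - y))\<^sup>2))"
  using assms strongly_convex_iff_finite_values[of \<phi> \<sigma>] by auto

lemma strongly_convex_norm_sq:
  fixes w :: "'a::real_inner"
  shows "strongly_convex 1 (\<lambda>u. ereal (1 / 2 * (norm (u - w))\<^sup>2))"
proof (subst strongly_convex_iff_finite_values, simp, clarify)
  fix x y :: 'a and t :: real
  have "(1 - t) *\<^sub>R x + t *\<^sub>R y - w = (1 - t) *\<^sub>R (x - w) + t *\<^sub>R (y - w)"
    by (simp add: algebra_simps)
  then show "ereal (1 / 2 * (norm ((1 - t) *\<^sub>R x + t *\<^sub>R y - w))\<^sup>2)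
     \<le> ereal ((1 - t) * (1 / 2 * (norm (x - w))\<^sup>2) + t * (1 / 2 * (norm (y - w))\<^sup>2)
         - 1 / 2 * (t * (1 - t) * (norm (x - y))\<^sup>2))"
    by (simp only: norm_combination_sq) (simp add: field_simps)
qed

section \<open>Stability under positive multiples and real-valued summands\<close>

text \<open>
  Both \<open>F\<close> and the objective of the proximal step have the form \<open>c * h + g\<close> with \<open>c > 0\<close> and \<open>g\<close>
  real-valued, which is why only sums of this shape are treated.
\<close>
lemma proper_scale_add_real:
  assumes "proper h" and "c > 0"
  shows "proper (\<lambda>u. ereal c * h u + ereal (g u))"
proof -
  obtain x where "h x \<noteq> \<infinity>" and ninf: "\<And>u. h u \<noteq> -\<infinity>"
    using assms(1) by (auto simp: proper_def)
  then have "ereal c * h x + ereal (g x) \<noteq> \<infinity>"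
    using \<open>c > 0\<close> by (cases "h x") auto
  moreover have "ereal c * h u + ereal (g u) \<noteq> -\<infinity>" for u
    using \<open>c > 0\<close> ninf[of u] by (cases "h u") auto
  ultimately show ?thesis
    unfolding proper_def by blast
qed

lemma strongly_convex_scale_add_real:
  fixes h :: "'a::real_inner \<Rightarrow> ereal"
  assumes "strongly_convex \<rho> h" and "proper h" and "c > 0"
    and "strongly_convex \<sigma> (\<lambda>u. ereal (g u))"
  shows "strongly_convex (c * \<rho> + \<sigma>) (\<lambda>u. ereal c * h u + ereal (g u))"
proof -
  have ninf: "\<And>u. h u \<noteq> -\<infinity>"
    using assms(2) by (auto simp: proper_def)
  have "\<And>u. ereal c * h u + ereal (g u) \<noteq> -\<infinity>"
    using proper_scale_add_real[OF assms(2,3)] by (auto simp: proper_def)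
  then show ?thesis
  proof (subst strongly_convex_iff_finite_values, simp, intro allI ballI impI)
    fix x y a b and t :: real
    assume t: "t \<in> {0<..<1}"
      and x: "ereal c * h x + ereal (g x) = ereal a"
      and y: "ereal c * h y + ereal (g y) = ereal b"
    let ?w = "(1 - t) *\<^sub>R x + t *\<^sub>R y" and ?d = "t * (1 - t) * (norm (x - y))\<^sup>2"
    obtain p q where hx: "h x = ereal p" and hy: "h y = ereal q"
      using x y \<open>c > 0\<close> by (cases "h x"; cases "h y") auto
    then have a: "a = c * p + g x" and b: "b = c * q + g y"
      using x y by auto
    have h: "h ?w \<le> ereal ((1 - t) * p + t * q - \<rho> / 2 * ?d)"
      using strongly_convexD[OF assms(1) ninf hx hy] t by auto
    have g: "g ?w \<le> (1 - t) * g x + t * g y - \<sigma> / 2 * ?d"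
      using strongly_convexD[OF assms(4)] t by auto
    obtain r where r: "h ?w = ereal r"
      using h ninf[of ?w] by (cases "h ?w") auto
    with h have "c * r \<le> c * ((1 - t) * p + t * q - \<rho> / 2 * ?d)"
      using \<open>c > 0\<close> by simp
    with g have "c * r + g ?w
        \<le> (1 - t) * a + t * b - (c * \<rho> + \<sigma>) / 2 * ?d"
      unfolding a b by (simp add: algebra_simps add_divide_distrib)
    then show "ereal c * h ?w + ereal (g ?w)
        \<le> ereal ((1 - t) * a + t * b - (c * \<rho> + \<sigma>) / 2 * ?d)"
      using r by simp
  qed
qed

lemma lower_semicontinuous_iff_real:
  "lower_semicontinuous \<phi> \<longleftrightarrow>
    (\<forall>x a. ereal a < \<phi> x \<longrightarrow> (\<forall>\<^sub>F u in nhds x. ereal a < \<phi> u))" (is "?L \<longleftrightarrow> ?R")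
proof
  assume ?L
  then show ?R
    by (auto simp: lower_semicontinuous_def le_Liminf_iff)
next
  assume R: ?R
  show ?L
    unfolding lower_semicontinuous_def le_Liminf_iff
  proof (intro allI impI)
    fix x b assume "b < \<phi> x"
    then obtain a where "b < ereal a" "ereal a < \<phi> x"
      using ereal_dense2 by blast
    with R have "\<forall>\<^sub>F u in nhds x. ereal a < \<phi> u"
      by blast
    then show "\<forall>\<^sub>F u in nhds x. b < \<phi> u"
      by eventually_elim (use \<open>b < ereal a\<close> in auto)
  qed
qed

lemma lower_semicontinuous_scale_add_real:
  fixes h :: "'a::topological_space \<Rightarrow> ereal"
  assumes "lower_semicontinuous h" and "proper h" and "c > 0"
    and "continuous_on UNIV g"
  shows "lower_semicontinuous (\<lambda>u. ereal c * h u + ereal (g u))"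
  unfolding lower_semicontinuous_iff_real
proof (intro allI impI)
  fix x a assume a: "ereal a < ereal c * h x + ereal (g x)"
  obtain e where "e > 0" and e: "ereal ((a - g x + e) / c) < h x"
  proof (cases "h x")
    case (real p)
    with a have "0 < (c * p + g x - a) / 2" by simp
    moreover have "(a - g x + (c * p + g x - a) / 2) / c < p"
      using a real \<open>c > 0\<close> by (simp add: field_simps)
    ultimately show ?thesis
      using that[of "(c * p + g x - a) / 2"] real by simp
  next
    case PInf
    then show ?thesis using that[of 1] by simp
  next
    case MInf
    then show ?thesis using assms(2) by (simp add: proper_def)
  qed
  have "\<forall>\<^sub>F u in nhds x. ereal ((a - g x + e) / c) < h u"
    using assms(1) e by (simp add: lower_semicontinuous_iff_real)
  moreover have "\<forall>\<^sub>F u in nhds x. g x - e < g u"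
  proof (rule order_tendstoD(1))
    show "(g \<longlongrightarrow> g x) (nhds x)"
      using assms(4) by (simp add: continuous_on_def flip: tendsto_at_iff_tendsto_nhds)
    show "g x - e < g x" using \<open>e > 0\<close> by simp
  qed
  ultimately show "\<forall>\<^sub>F u in nhds x. ereal a < ereal c * h u + ereal (g u)"
  proof eventually_elim
    case (elim u)
    then show ?case
      using \<open>c > 0\<close> by (cases "h u") (auto simp: field_simps)
  qed
qed

section \<open>Existence of minimizers\<close>

text \<open>
  Lower semicontinuity bounds \<open>\<phi>\<close> from below on a ball around a point \<open>x\<close> of finite value. For \<open>u\<close> far
  from \<open>x\<close>, the segment from \<open>x\<close> to \<open>u\<close> meets the ball, and strong convexity along the segment turns
  the bound there into a bound on \<open>\<phi> u\<close>: convexity alone would allow a linear decrease in the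
  distance, but the quadratic gain dominates it.
\<close>
lemma strongly_convex_bounded_below:
  fixes \<phi> :: "'a::real_inner \<Rightarrow> ereal"
  assumes "\<sigma> > 0" and "proper \<phi>" and "lower_semicontinuous \<phi>" and "strongly_convex \<sigma> \<phi>"
  obtains m where "\<And>u. ereal m \<le> \<phi> u"
proof -
  have ninf: "\<And>u. \<phi> u \<noteq> -\<infinity>" and "\<exists>x. \<phi> x \<noteq> \<infinity>"
    using assms(2) by (auto simp: proper_def)
  then obtain x a where x: "\<phi> x = ereal a"
    by (metis ereal_cases)
  then have "ereal (a - 1) < \<phi> x" by simp
  then have "\<forall>\<^sub>F u in nhds x. ereal (a - 1) < \<phi> u"
    using assms(3) by (simp only: lower_semicontinuous_iff_real)
  then obtain r where "r > 0" and r: "\<And>u. dist u x < r \<Longrightarrow> ereal (a - 1) < \<phi> u"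
    by (auto simp: eventually_nhds_metric)
  (* The half keeps points at distance s strictly inside the ball. *)
  define s where "s = r / 2"
  have "s > 0" using \<open>r > 0\<close> by (simp add: s_def)
  define C where "C = 1 / s + \<sigma> / 2 * s"
  (* Complete the square: at distance d the gain is \<sigma>/2 d^2 and the loss is at most C d. *)
  have C: "\<sigma> / 2 * d\<^sup>2 - C * d \<ge> - (C\<^sup>2 / (2 * \<sigma>))" for d
  proof -
    have "0 \<le> (\<sigma> * d - C)\<^sup>2 / (2 * \<sigma>)" using \<open>\<sigma> > 0\<close> by simp
    also have "\<dots> = \<sigma> / 2 * d\<^sup>2 - C * d + C\<^sup>2 / (2 * \<sigma>)"
      using \<open>\<sigma> > 0\<close> by (simp add: field_simps power2_eq_square)
    finally show ?thesis by simp
  qed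
  have "ereal (a - 1 - C\<^sup>2 / (2 * \<sigma>)) \<le> \<phi> u" for u
  proof (cases "dist u x < r")
    case True
    have "ereal (a - 1 - C\<^sup>2 / (2 * \<sigma>)) \<le> ereal (a - 1)" using \<open>\<sigma> > 0\<close> by simp
    also have "\<dots> \<le> \<phi> u" using r[OF True] by simp
    finally show ?thesis .
  next
    case False
    show ?thesis
    proof (cases "\<phi> u")
      case (real b)
      define d where "d = norm (x - u)"
      define t where "t = s / d"
      have d: "d \<ge> r" using False by (simp add: d_def dist_norm norm_minus_commute)
      then have "d > 0" using \<open>r > 0\<close> by simp
      have t: "0 < t" "t < 1" and td: "t * d = s"
        using d \<open>r > 0\<close> by (auto simp: t_def s_def)
      let ?w = "(1 - t) *\<^sub>R x + t *\<^sub>R u"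
      have "?w - x = t *\<^sub>R (u - x)" by (simp add: algebra_simps)
      then have "dist ?w x = s"
        using t td by (simp add: dist_norm d_def norm_minus_commute)
      then have "ereal (a - 1) < \<phi> ?w"
        using r \<open>r > 0\<close> by (simp add: s_def)
      also have "\<phi> ?w \<le> ereal ((1 - t) * a + t * b - \<sigma> / 2 * (t * (1 - t) * d\<^sup>2))"
        using strongly_convexD[OF assms(4) ninf x real t] by (simp add: d_def)
      finally have "a - 1 < (1 - t) * a + t * b - \<sigma> / 2 * (t * (1 - t) * d\<^sup>2)"
        by simp
      then have "t * a < t * (b - \<sigma> / 2 * ((1 - t) * d\<^sup>2)) + 1"
        by (simp add: algebra_simps)
      then have "a < b - \<sigma> / 2 * ((1 - t) * d\<^sup>2) + 1 / t"
        using t by (simp add: field_simps)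
      also have "(1 - t) * d\<^sup>2 = d\<^sup>2 - s * d"
        using td by (simp add: algebra_simps power2_eq_square)
      also have "1 / t = d / s" by (simp add: t_def)
      finally have "a + (\<sigma> / 2 * d\<^sup>2 - C * d) < b"
        by (simp add: C_def algebra_simps)
      with C[of d] show ?thesis by (simp add: real)
    qed (use ninf in auto)
  qed
  then show ?thesis using that by blast
qed

text \<open>
  At the midpoint of two almost minimizing points, strong convexity would give a value below the
  infimum unless the points are close. So every minimizing sequence is Cauchy, and by lower
  semicontinuity its limit attains the infimum.
\<close>
lemma strongly_convex_has_minimizer:
  fixes \<phi> :: "'a::{real_inner, complete_space} \<Rightarrow> ereal"
  assumes "\<sigma> > 0" and "proper \<phi>" and "lower_semicontinuous \<phi>" and "strongly_convex \<sigma> \<phi>"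
  obtains p where "\<And>u. \<phi> p \<le> \<phi> u"
proof -
  have ninf: "\<And>u. \<phi> u \<noteq> -\<infinity>" and "\<exists>x. \<phi> x \<noteq> \<infinity>"
    using assms(2) by (auto simp: proper_def)
  then obtain x0 a0 where x0: "\<phi> x0 = ereal a0"
    by (metis ereal_cases)
  obtain m0 where m0: "\<And>u. ereal m0 \<le> \<phi> u"
    using strongly_convex_bounded_below[OF assms] by blast
  have "ereal m0 \<le> (INF u. \<phi> u)" using m0 by (simp add: INF_greatest)
  moreover have "(INF u. \<phi> u) \<le> ereal a0" using x0 by (metis INF_lower UNIV_I)
  ultimately obtain m where m: "(INF u. \<phi> u) = ereal m"
    by (cases "INF u. \<phi> u") auto
  then have le: "ereal m \<le> \<phi> u" for u
    by (metis INF_lower UNIV_I)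
  have "\<exists>u. \<phi> u < ereal (m + 1 / real (Suc n))" for n
  proof -
    have "(INF u. \<phi> u) < ereal (m + 1 / real (Suc n))" unfolding m by simp
    then show ?thesis by (simp add: INF_less_iff)
  qed
  then obtain X where X: "\<And>n. \<phi> (X n) < ereal (m + 1 / real (Suc n))"
    by metis
  define A where "A n = real_of_ereal (\<phi> (X n))" for n
  have A: "\<phi> (X n) = ereal (A n)" for n
    using X[of n] ninf[of "X n"] by (cases "\<phi> (X n)") (auto simp: A_def)
  have near: "\<sigma> / 8 * (norm (X i - X j))\<^sup>2 \<le> (1 / real (Suc i) + 1 / real (Suc j)) / 2" for i j
  proof -
    have "ereal m \<le> \<phi> ((1 - 1 / 2) *\<^sub>R X i + (1 / 2) *\<^sub>R X j)" by (rule le)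
    also have "\<dots> \<le> ereal ((1 - 1 / 2) * A i + 1 / 2 * A j
        - \<sigma> / 2 * (1 / 2 * (1 - 1 / 2) * (norm (X i - X j))\<^sup>2))"
      by (rule strongly_convexD[OF assms(4) ninf A A]) auto
    finally have "m \<le> A i / 2 + A j / 2 - \<sigma> / 8 * (norm (X i - X j))\<^sup>2"
      by simp
    moreover have "A i < m + 1 / real (Suc i)" "A j < m + 1 / real (Suc j)"
      using X[of i] X[of j] by (simp_all add: A)
    ultimately show ?thesis by argo
  qed
  have "Cauchy X"
    unfolding Cauchy_def
  proof (intro allI impI)
    fix e :: real assume "e > 0"
    then have "0 < \<sigma> / 8 * e\<^sup>2" using \<open>\<sigma> > 0\<close> by simp
    then obtain N where N: "1 / real (Suc N) < \<sigma> / 8 * e\<^sup>2"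
      using nat_approx_posE by blast
    have "dist (X i) (X j) < e" if "N \<le> i" "N \<le> j" for i j
    proof -
      have "1 / real (Suc i) \<le> 1 / real (Suc N)" "1 / real (Suc j) \<le> 1 / real (Suc N)"
        using that by (auto intro!: divide_left_mono)
      with near[of i j] N have "\<sigma> / 8 * (norm (X i - X j))\<^sup>2 < \<sigma> / 8 * e\<^sup>2"
        by argo
      then have "(norm (X i - X j))\<^sup>2 < e\<^sup>2" using \<open>\<sigma> > 0\<close> by simp
      then show ?thesis
        using \<open>e > 0\<close> by (simp add: dist_norm power_less_imp_less_base)
    qed
    then show "\<exists>N. \<forall>i\<ge>N. \<forall>j\<ge>N. dist (X i) (X j) < e" by blast
  qed
  then obtain p where p: "X \<longlonglongrightarrow> p"
    by (auto simp: Cauchy_convergent_iff convergent_def)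
  have "\<phi> p \<le> ereal m"
  proof (rule ccontr)
    assume "\<not> \<phi> p \<le> ereal m"
    then have "ereal m < \<phi> p" by simp
    then obtain c where c: "ereal m < ereal c" "ereal c < \<phi> p"
      using ereal_dense2 by blast
    then have "\<forall>\<^sub>F u in nhds p. ereal c < \<phi> u"
      using assms(3) by (simp add: lower_semicontinuous_iff_real)
    then have "\<forall>\<^sub>F n in sequentially. ereal c < \<phi> (X n)"
      using p filterlim_iff[of X "nhds p" sequentially] by blast
    moreover have "\<forall>\<^sub>F n in sequentially. 1 / real (Suc n) < c - m"
      using c by (intro order_tendstoD(2)[OF LIMSEQ_inverse_real_of_nat[unfolded inverse_eq_divide]]) simp
    ultimately have "\<forall>\<^sub>F n in sequentially. False"
    proof eventually_elim
      case (elim n)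
      then show ?case using X[of n] by (simp add: A)
    qed
    then show False by simp
  qed
  then have "\<phi> p \<le> \<phi> u" for u using le order_trans by blast
  then show ?thesis using that by blast
qed

lemma arg_min_minimizes:
  fixes \<phi> :: "'a::{real_inner, complete_space} \<Rightarrow> ereal"
  assumes "\<sigma> > 0" and "proper \<phi>" and "lower_semicontinuous \<phi>" and "strongly_convex \<sigma> \<phi>"
  shows "\<phi> (arg_min \<phi> (\<lambda>_. True)) \<le> \<phi> u"
proof -
  obtain p where "\<And>u. \<phi> p \<le> \<phi> u"
    using strongly_convex_has_minimizer[OF assms] by blast
  then have "is_arg_min \<phi> (\<lambda>_. True) p"
    by (simp add: is_arg_min_linorder)
  then have "is_arg_min \<phi> (\<lambda>_. True) (arg_min \<phi> (\<lambda>_. True))"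
    unfolding arg_min_def by (rule someI)
  then show ?thesis by (simp add: is_arg_min_linorder)
qed

lemma proper_minimum_finite:
  assumes "proper \<phi>" and "\<And>u. \<phi> p \<le> \<phi> u"
  obtains a where "\<phi> p = ereal a"
  using assms by (metis ereal_cases ereal_infty_less_eq(1) proper_def)

text \<open>
  On the segment from the minimizer \<open>p\<close> to \<open>u\<close>, minimality and strong convexity give
  \<open>a + \<sigma>/2 (1 - t) |p - u|^2 \<le> b\<close> after division by the weight \<open>t\<close>; let \<open>t\<close> tend to \<open>0\<close>. When
  \<open>p\<close> is the proximal point of \<open>w\<close>, this inequality carries the information that \<open>w - p\<close> is a
  subgradient at \<open>p\<close>.
\<close>
lemma quadratic_growth_at_minimizer:
  fixes \<phi> :: "'a::real_inner \<Rightarrow> ereal"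
  assumes "strongly_convex \<sigma> \<phi>" and "\<And>u. \<phi> u \<noteq> -\<infinity>"
    and min: "\<And>u. \<phi> p \<le> \<phi> u" and p: "\<phi> p = ereal a" and u: "\<phi> u = ereal b"
  shows "a + \<sigma> / 2 * (norm (u - p))\<^sup>2 \<le> b"
proof -
  have "a + \<sigma> / 2 * ((1 - t) * (norm (p - u))\<^sup>2) \<le> b" if t: "0 < t" "t < 1" for t
  proof -
    have "ereal a \<le> ereal ((1 - t) * a + t * b - \<sigma> / 2 * (t * (1 - t) * (norm (p - u))\<^sup>2))"
      using order_trans[OF min strongly_convexD[OF assms(1,2) p u t]] by (simp add: p)
    then have "t * (a + \<sigma> / 2 * ((1 - t) * (norm (p - u))\<^sup>2)) \<le> t * b"
      by (simp add: algebra_simps)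
    then show ?thesis using t by simp
  qed
  then have "\<forall>\<^sub>F t in at_right 0. a + \<sigma> / 2 * ((1 - t) * (norm (p - u))\<^sup>2) \<le> b"
    using eventually_at_right_less[of 0] eventually_at_right_real[of 0 1]
    by (auto elim: eventually_mono)
  moreover have "((\<lambda>t. a + \<sigma> / 2 * ((1 - t) * (norm (p - u))\<^sup>2))
      \<longlongrightarrow> a + \<sigma> / 2 * ((1 - 0) * (norm (p - u))\<^sup>2)) (at_right 0)"
    by (intro tendsto_intros)
  ultimately show ?thesis
    using tendsto_upperbound[of _ _ "at_right 0" b]
    by (fastforce simp: norm_minus_commute)
qed

section \<open>Quadratic bounds for the smooth part\<close>

lemma GDERIV_along_line:
  assumes "\<And>u. GDERIV f u :> grad_f u"
  shows "((\<lambda>t. f (y + t *\<^sub>R d)) has_real_derivative grad_f (y + t *\<^sub>R d) \<bullet> d) (at t)"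
proof -
  have "((\<lambda>t. f (y + t *\<^sub>R d)) has_derivative (\<lambda>s. (s *\<^sub>R d) \<bullet> grad_f (y + t *\<^sub>R d))) (at t)"
    by (rule has_derivative_compose[of "\<lambda>t. y + t *\<^sub>R d" "\<lambda>s. s *\<^sub>R d"])
      (use assms[unfolded gderiv_def] in \<open>auto intro!: derivative_eq_intros\<close>)
  then show ?thesis
    by (simp add: has_field_derivative_def inner_commute mult.commute[of _ "_ \<bullet> _"])
qed

text \<open>
  The strong convexity inequality bounds the difference quotient of \<open>f\<close> at \<open>y\<close> in the direction
  \<open>u - y\<close>; the bound passes to the limit.
\<close>
lemma strongly_convex_gradient_lower_bound:
  fixes f :: "'a::real_inner \<Rightarrow> real"
  assumes "\<And>u. GDERIV f u :> grad_f u" and "strongly_convex \<mu> (\<lambda>u. ereal (f u))"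
  shows "f y + grad_f y \<bullet> (u - y) + \<mu> / 2 * (norm (u - y))\<^sup>2 \<le> f u"
proof -
  let ?d = "u - y"
  have "(f (y + t *\<^sub>R ?d) - f y) / t \<le> f u - f y - \<mu> / 2 * ((1 - t) * (norm ?d)\<^sup>2)"
    if t: "0 < t" "t < 1" for t
  proof -
    have "(1 - t) *\<^sub>R y + t *\<^sub>R u = y + t *\<^sub>R ?d" by (simp add: algebra_simps)
    then have "f (y + t *\<^sub>R ?d)
        \<le> (1 - t) * f y + t * f u - \<mu> / 2 * (t * (1 - t) * (norm ?d)\<^sup>2)"
      using strongly_convexD[OF assms(2) _ refl refl t, of y u]
      by (simp add: norm_minus_commute)
    then show ?thesis using t by (simp add: field_simps)
  qed
  then have ev: "\<forall>\<^sub>F t in at_right 0. (f (y + t *\<^sub>R ?d) - f y) / t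
      \<le> f u - f y - \<mu> / 2 * ((1 - t) * (norm ?d)\<^sup>2)"
    using eventually_at_right_less[of 0] eventually_at_right_real[of 0 1]
    by (auto elim: eventually_mono)
  have "((\<lambda>t. (f (y + t *\<^sub>R ?d) - f y) / t) \<longlongrightarrow> grad_f y \<bullet> ?d) (at 0)"
    using GDERIV_along_line[OF assms(1), of y ?d 0] by (simp add: DERIV_def)
  then have lim: "((\<lambda>t. (f (y + t *\<^sub>R ?d) - f y) / t) \<longlongrightarrow> grad_f y \<bullet> ?d) (at_right 0)"
    by (rule tendsto_within_subset) auto
  have "((\<lambda>t. f u - f y - \<mu> / 2 * ((1 - t) * (norm ?d)\<^sup>2))
      \<longlongrightarrow> f u - f y - \<mu> / 2 * ((1 - 0) * (norm ?d)\<^sup>2)) (at_right 0)"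
    by (intro tendsto_intros)
  from tendsto_le[OF _ this lim ev] show ?thesis by simp
qed

text \<open>
  Along the segment from \<open>y\<close> to \<open>p\<close>, the difference between \<open>f\<close> and its quadratic upper model at \<open>y\<close>
  has a nonpositive derivative, by the Lipschitz bound on the gradient.
\<close>
lemma descent_lemma:
  fixes f :: "'a::real_inner \<Rightarrow> real"
  assumes "\<And>u. GDERIV f u :> grad_f u" and "L-lipschitz_on UNIV grad_f"
  shows "f p \<le> f y + grad_f y \<bullet> (p - y) + L / 2 * (norm (p - y))\<^sup>2"
proof -
  let ?d = "p - y"
  define g where "g t = f (y + t *\<^sub>R ?d) - t * (grad_f y \<bullet> ?d) - L / 2 * t\<^sup>2 * (norm ?d)\<^sup>2" for t
  have "g 1 \<le> g 0"
  proof (rule DERIV_nonpos_imp_nonincreasing[of 0 1 g])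
    fix t :: real assume t: "0 \<le> t" "t \<le> 1"
    have "(g has_real_derivative
        grad_f (y + t *\<^sub>R ?d) \<bullet> ?d - grad_f y \<bullet> ?d - L * t * (norm ?d)\<^sup>2) (at t)"
      unfolding g_def
      by (auto intro!: derivative_eq_intros GDERIV_along_line[OF assms(1)])
    moreover have "grad_f (y + t *\<^sub>R ?d) \<bullet> ?d - grad_f y \<bullet> ?d - L * t * (norm ?d)\<^sup>2 \<le> 0"
    proof -
      have "grad_f (y + t *\<^sub>R ?d) \<bullet> ?d - grad_f y \<bullet> ?d
          = (grad_f (y + t *\<^sub>R ?d) - grad_f y) \<bullet> ?d"
        by (simp add: inner_diff_left)
      also have "\<dots> \<le> norm (grad_f (y + t *\<^sub>R ?d) - grad_f y) * norm ?d"
        by (rule norm_cauchy_schwarz)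
      also have "\<dots> \<le> (L * norm (t *\<^sub>R ?d)) * norm ?d"
        using lipschitz_onD[OF assms(2), of "y + t *\<^sub>R ?d" y]
        by (intro mult_right_mono) (auto simp: dist_norm)
      finally show ?thesis using t by (simp add: power2_eq_square)
    qed
    ultimately show "\<exists>D. (g has_real_derivative D) (at t) \<and> D \<le> 0" by blast
  qed simp
  then show ?thesis by (simp add: g_def)
qed

section \<open>The proximal gradient step\<close>

text \<open>
  With \<open>w = y - grad_f y / L\<close>, quadratic growth of the prox objective around \<open>p\<close> reads, after
  expanding the squares centred at \<open>w\<close> around \<open>y\<close>, as a comparison of \<open>h\<close> plus the quadratic model of
  \<open>f\<close> at \<open>y\<close> in the points \<open>p\<close> and \<open>u\<close>. At \<open>p\<close> the model lies above \<open>f\<close>; at \<open>u\<close> it exceeds \<open>f\<close> by at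
  most \<open>(L - \<mu>)/2 |u - y|^2\<close>. The modulus \<open>\<rho>\<close> of \<open>h\<close> enters through the growth, whose constant
  \<open>\<rho>/L + 1\<close> becomes \<open>L + \<rho>\<close> after multiplication by \<open>L\<close>.
\<close>
lemma proximal_gradient_inequality:
  fixes f :: "'a::{real_inner, complete_space} \<Rightarrow> real" and h :: "'a \<Rightarrow> ereal"
  assumes "L > 0" and "\<rho> \<ge> 0"
    and grad: "\<And>u. GDERIV f u :> grad_f u"
    and f: "strongly_convex \<mu> (\<lambda>u. ereal (f u))"
    and lip: "L-lipschitz_on UNIV grad_f"
    and h: "proper h" "lower_semicontinuous h" "strongly_convex \<rho> h"
    and p: "p = prox (\<lambda>u. ereal (1 / L) * h u) (y - (1 / L) *\<^sub>R grad_f y)"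
  obtains a where "h p = ereal a"
    and "\<And>u b. h u = ereal b \<Longrightarrow>
      f p + a + (L + \<rho>) / 2 * (norm (u - p))\<^sup>2 \<le> f u + b + (L - \<mu>) / 2 * (norm (u - y))\<^sup>2"
proof -
  define w where "w = y - (1 / L) *\<^sub>R grad_f y"
  define \<psi> where "\<psi> u = ereal (1 / L) * h u + ereal (1 / 2 * (norm (u - w))\<^sup>2)" for u
  have "1 / L > 0" using \<open>L > 0\<close> by simp
  have "continuous_on UNIV (\<lambda>u. 1 / 2 * (norm (u - w))\<^sup>2)"
    by (intro continuous_intros)
  note lsc = lower_semicontinuous_scale_add_real[OF h(2,1) \<open>1 / L > 0\<close> this]
  have pos: "1 / L * \<rho> + 1 > 0" using \<open>L > 0\<close> \<open>\<rho> \<ge> 0\<close> by (simp add: add_nonneg_pos)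
  have "proper \<psi>"
    unfolding \<psi>_def by (rule proper_scale_add_real[OF h(1) \<open>1 / L > 0\<close>])
  moreover have "lower_semicontinuous \<psi>"
    unfolding \<psi>_def by (rule lsc)
  moreover have "strongly_convex (1 / L * \<rho> + 1) \<psi>"
    unfolding \<psi>_def
    by (rule strongly_convex_scale_add_real[OF h(3,1) \<open>1 / L > 0\<close> strongly_convex_norm_sq])
  ultimately have \<psi>: "proper \<psi>" "lower_semicontinuous \<psi>"
      "strongly_convex (1 / L * \<rho> + 1) \<psi>" .
  have "p = arg_min \<psi> (\<lambda>_. True)"
    unfolding p prox_def \<psi>_def[abs_def] w_def ..
  then have min: "\<psi> p \<le> \<psi> u" for u
    using arg_min_minimizes[OF pos \<psi>] by simp
  obtain e where e: "\<psi> p = ereal e"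
    using proper_minimum_finite[OF \<psi>(1) min] by blast
  then obtain a where a: "h p = ereal a"
    using \<open>L > 0\<close> by (cases "h p") (auto simp: \<psi>_def)
  show ?thesis
  proof (rule that[OF a])
    fix u b assume b: "h u = ereal b"
    have "a / L + 1 / 2 * (norm (p - w))\<^sup>2 + (1 / L * \<rho> + 1) / 2 * (norm (u - p))\<^sup>2
        \<le> b / L + 1 / 2 * (norm (u - w))\<^sup>2"
      by (rule quadratic_growth_at_minimizer[OF \<psi>(3) _ min])
        (use \<psi>(1) in \<open>auto simp: proper_def \<psi>_def a b\<close>)
    then have "L * (a / L + 1 / 2 * (norm (p - w))\<^sup>2 + (1 / L * \<rho> + 1) / 2 * (norm (u - p))\<^sup>2)
        \<le> L * (b / L + 1 / 2 * (norm (u - w))\<^sup>2)"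
      using \<open>L > 0\<close> by (intro mult_left_mono) auto
    moreover have "L * ((1 / L * \<rho> + 1) / 2) = (L + \<rho>) / 2"
      using \<open>L > 0\<close> by (simp add: field_simps)
    ultimately have growth: "a + L * (norm (p - w))\<^sup>2 / 2 + (L + \<rho>) / 2 * (norm (u - p))\<^sup>2
        \<le> b + L * (norm (u - w))\<^sup>2 / 2"
      using \<open>L > 0\<close> by (simp add: distrib_left add.commute flip: mult.assoc)
    (* L |v - w|^2 is twice the quadratic model of f at y, up to a term that is constant in v. *)
    have sq: "L * (norm (v - w))\<^sup>2
        = L * (norm (v - y))\<^sup>2 + 2 * (grad_f y \<bullet> (v - y)) + L * (norm (y - w))\<^sup>2" for v
    proof -
      have "L *\<^sub>R (y - w) = grad_f y" using \<open>L > 0\<close> by (simp add: w_def)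
      then have "grad_f y \<bullet> (v - y) = L * ((y - w) \<bullet> (v - y))"
        by (metis inner_scaleR_left)
      moreover have "(norm (v - w))\<^sup>2
          = (norm (v - y))\<^sup>2 + 2 * ((y - w) \<bullet> (v - y)) + (norm (y - w))\<^sup>2"
        unfolding power2_norm_eq_inner
        by (simp add: inner_diff_left inner_diff_right inner_commute)
      ultimately show ?thesis by (simp only: distrib_left mult.left_commute)
    qed
    have "a + L / 2 * (norm (p - y))\<^sup>2 + grad_f y \<bullet> (p - y) + (L + \<rho>) / 2 * (norm (u - p))\<^sup>2
        \<le> b + L / 2 * (norm (u - y))\<^sup>2 + grad_f y \<bullet> (u - y)"
      using growth unfolding sq[of p] sq[of u] by (simp add: add_divide_distrib)
    moreover have "f p \<le> f y + grad_f y \<bullet> (p - y) + L / 2 * (norm (p - y))\<^sup>2"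
      by (rule descent_lemma[OF grad lip])
    moreover have "f y + grad_f y \<bullet> (u - y) + \<mu> / 2 * (norm (u - y))\<^sup>2 \<le> f u"
      by (rule strongly_convex_gradient_lower_bound[OF grad f])
    ultimately show "f p + a + (L + \<rho>) / 2 * (norm (u - p))\<^sup>2
        \<le> f u + b + (L - \<mu>) / 2 * (norm (u - y))\<^sup>2"
      by (simp add: field_simps)
  qed
qed

section \<open>Contraction of the energy\<close>

text \<open>
  Substituting the relation for \<open>y\<close> gives \<open>(1 + q) (u - y) = - q (q (x - s) + (z - s))\<close> for
  \<open>u = (1 - q) x + q s\<close>, and convexity of the squared norm with weights \<open>q/(1 + q)\<close> and \<open>1/(1 + q)\<close>
  bounds the right side. The factor \<open>1 - q^2\<close> is \<open>(L - \<mu>)/(L + \<rho>)\<close> in the application.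
\<close>
lemma extrapolation_distance_bound:
  fixes x y z s :: "'a::real_inner"
  assumes "0 < q" and "q < 1" and y: "(1 + q) *\<^sub>R y = x + q *\<^sub>R z"
  shows "(1 - q\<^sup>2) * (norm ((1 - q) *\<^sub>R x + q *\<^sub>R s - y))\<^sup>2
    \<le> q\<^sup>2 * (1 - q) * ((norm (z - s))\<^sup>2 + q * (norm (x - s))\<^sup>2)"
proof -
  define u where "u = (1 - q) *\<^sub>R x + q *\<^sub>R s"
  define N where "N = (norm (z - s))\<^sup>2 + q * (norm (x - s))\<^sup>2"
  have "(1 + q) *\<^sub>R (u - y) = - q *\<^sub>R (q *\<^sub>R (x - s) + (z - s))"
    unfolding scaleR_diff_right[of "1 + q"] y unfolding u_def
    by (simp add: algebra_simps)
  then have "(norm ((1 + q) *\<^sub>R (u - y)))\<^sup>2 = (norm (- q *\<^sub>R (q *\<^sub>R (x - s) + (z - s))))\<^sup>2"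
    by simp
  then have "(1 + q)\<^sup>2 * (norm (u - y))\<^sup>2 = q\<^sup>2 * (norm (q *\<^sub>R (x - s) + (z - s)))\<^sup>2"
    by (simp add: power_mult_distrib)
  also have "(norm (q *\<^sub>R (x - s) + (z - s)))\<^sup>2
      = (1 + q) * N - q * (norm ((x - s) - (z - s)))\<^sup>2"
    unfolding N_def power2_norm_eq_inner
    by (simp add: inner_add inner_diff inner_commute algebra_simps)
  also have "q\<^sup>2 * ((1 + q) * N - q * (norm ((x - s) - (z - s)))\<^sup>2) \<le> q\<^sup>2 * ((1 + q) * N)"
    using \<open>0 < q\<close> by (intro mult_left_mono) auto
  finally have "(1 + q) * ((1 + q) * (norm (u - y))\<^sup>2) \<le> (1 + q) * (q\<^sup>2 * N)"
    by (simp add: power2_eq_square algebra_simps)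
  then have "(1 + q) * (norm (u - y))\<^sup>2 \<le> q\<^sup>2 * N"
    using \<open>0 < q\<close> by simp
  then have "(1 - q) * ((1 + q) * (norm (u - y))\<^sup>2) \<le> (1 - q) * (q\<^sup>2 * N)"
    using \<open>q < 1\<close> by (intro mult_left_mono) auto
  then show ?thesis
    unfolding u_def N_def by (simp add: power2_eq_square algebra_simps)
qed

theorem theorem3p1:
  fixes L \<mu> \<rho> \<gamma> \<alpha> :: real
    and f :: "'a::{real_inner, complete_space} \<Rightarrow> real"
    and grad_f :: "'a \<Rightarrow> 'a"
    and h F :: "'a \<Rightarrow> ereal"
    and x_star :: 'a
    and x y z :: "nat \<Rightarrow> 'a"
    and \<Phi> :: "'a \<Rightarrow> 'a \<Rightarrow> ereal"
  assumes "L > 0" and "0 \<le> \<mu>" and "\<mu> < L" and "\<rho> \<ge> 0" and "\<mu> + \<rho> > 0"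
    and "\<And>u. GDERIV f u :> grad_f u"
    and "strongly_convex \<mu> (\<lambda>u. ereal (f u))"
    and "L-lipschitz_on UNIV grad_f"
    and "proper h" and "lower_semicontinuous h" and "strongly_convex \<rho> h"
    and "F = (\<lambda>u. ereal (f u) + h u)"
    and "x_star = arg_min F (\<lambda>_. True)"
    and "\<gamma> = 1 / L"
    and "\<alpha> = (sqrt (L + \<rho>) - sqrt (\<mu> + \<rho>)) / (sqrt (L + \<rho>) + sqrt (\<mu> + \<rho>))"
    and "\<And>k. x (Suc k) = prox (\<lambda>u. ereal \<gamma> * h u) (y k - \<gamma> *\<^sub>R grad_f (y k))"
    and "\<And>k. y (Suc k) = x (Suc k) + \<alpha> *\<^sub>R (x (Suc k) - x k)"
    and "\<And>k. z k = x k + ((sqrt (L + \<rho>) + sqrt (\<mu> + \<rho>)) / sqrt (\<mu> + \<rho>)) *\<^sub>R (y k - x k)"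
    and "\<Phi> = (\<lambda>u v. F u - F x_star + ereal ((\<mu> + \<rho>) / 2 * (norm (v - x_star))\<^sup>2))"
  shows "\<forall>k. \<Phi> (x (Suc k)) (z (Suc k)) \<le> ereal (1 - sqrt ((\<mu> + \<rho>) / (L + \<rho>))) * \<Phi> (x k) (z k)"
proof
  fix k
  define m where "m = \<mu> + \<rho>"
  define q where "q = sqrt (m / (L + \<rho>))"
  have "m > 0" "m < L + \<rho>"
    using assms(3,5) by (auto simp: m_def)
  then have q: "0 < q" "q < 1" and q2: "(L + \<rho>) * q\<^sup>2 = m"
    by (auto simp: q_def real_sqrt_lt_1_iff)
  define A B where "A = sqrt (L + \<rho>)" and "B = sqrt m"
  have "A > 0" "B > 0" "q = B / A"
    using \<open>m > 0\<close> \<open>m < L + \<rho>\<close> by (auto simp: A_def B_def q_def real_sqrt_divide)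
  then have AB: "A > 0" "B > 0" "A + B \<noteq> 0" "q = B / A"
    by auto
  have ratio: "(A + B) / B = (1 + q) / q"
    using AB(1,2) by (simp add: AB(4) field_simps)
  have "(A + B) / B * \<alpha> = (A - B) / B"
    using AB by (simp add: assms(15) A_def B_def m_def)
  also have "\<dots> = (1 - q) / q"
    using AB(1,2) by (simp add: AB(4) field_simps)
  finally have ratio_\<alpha>: "(1 + q) / q * \<alpha> = (1 - q) / q"
    unfolding ratio .
  (* In terms of z, the point y is a convex combination of x and z, and the new iterate is a convex
     combination of x and the new z; this is what the values of \<alpha> and of the factor in z achieve. *)
  have "z k = x k + ((1 + q) / q) *\<^sub>R (y k - x k)"
    using assms(18)[of k] by (simp only: ratio flip: m_def A_def B_def)
  then have "q *\<^sub>R z k = q *\<^sub>R x k + (1 + q) *\<^sub>R (y k - x k)"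
    using q by (simp add: scaleR_add_right)
  then have yz: "(1 + q) *\<^sub>R y k = x k + q *\<^sub>R z k"
    by (simp add: algebra_simps)
  have "z (Suc k) = x (Suc k) + ((1 + q) / q * \<alpha>) *\<^sub>R (x (Suc k) - x k)"
    using assms(18)[of "Suc k", folded m_def, folded A_def B_def, unfolded ratio] assms(17)[of k]
    by simp
  then have "q *\<^sub>R z (Suc k) = q *\<^sub>R x (Suc k) + (1 - q) *\<^sub>R (x (Suc k) - x k)"
    unfolding ratio_\<alpha> using q by (simp add: scaleR_add_right)
  then have xz: "x (Suc k) = (1 - q) *\<^sub>R x k + q *\<^sub>R z (Suc k)"
    by (simp add: algebra_simps)

  have F: "F = (\<lambda>u. ereal 1 * h u + ereal (f u))"
    unfolding assms(12) by (simp add: add.commute one_ereal_def[symmetric])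
  have "continuous_on UNIV f"
    using assms(6) unfolding gderiv_def
    by (meson continuous_at_imp_continuous_on has_derivative_continuous)
  then have F_proper: "proper F" and "lower_semicontinuous F" and F_convex: "strongly_convex m F"
    unfolding F
    using proper_scale_add_real[OF assms(9), of 1 f]
      lower_semicontinuous_scale_add_real[OF assms(10,9), of 1 f]
      strongly_convex_scale_add_real[OF assms(11,9) _ assms(7), of 1]
    by (auto simp: m_def add.commute)
  then have "F x_star \<le> F u" for u
    unfolding assms(13) using arg_min_minimizes[OF \<open>m > 0\<close>] by blast
  then obtain Fs where Fs: "F x_star = ereal Fs"
    using proper_minimum_finite[OF F_proper] by blast
  have ninf: "F u \<noteq> -\<infinity>" for u
    using F_proper by (auto simp: proper_def)
  show "\<Phi> (x (Suc k)) (z (Suc k)) \<le> ereal (1 - sqrt ((\<mu> + \<rho>) / (L + \<rho>))) * \<Phi> (x k) (z k)"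
  proof (cases "F (x k)")
    (* The right side is infinite because 1 - q is positive. Proximal points have finite values,
       so only the arbitrary starting point x 0 can lead to this case. *)
    case PInf
    then have "\<Phi> (x k) (z k) = \<infinity>" by (simp add: assms(19) Fs)
    moreover have "ereal (1 - q) * \<infinity> = \<infinity>" using q by simp
    ultimately show ?thesis by (simp only: flip: m_def q_def) simp
  next
    case MInf
    then show ?thesis using ninf by simp
  next
    case (real Fx)
    (* Mixing with weight q makes u - x (Suc k) a multiple of x_star - z (Suc k). *)
    define u where "u = (1 - q) *\<^sub>R x k + q *\<^sub>R x_star"
    have Fu_le: "F u \<le> ereal ((1 - q) * Fx + q * Fs - m / 2 * (q * (1 - q) * (norm (x k - x_star))\<^sup>2))"
      unfolding u_def by (rule strongly_convexD[OF F_convex ninf real Fs q])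
    obtain a where a: "h (x (Suc k)) = ereal a"
      and step: "\<And>u b. h u = ereal b \<Longrightarrow>
        f (x (Suc k)) + a + (L + \<rho>) / 2 * (norm (u - x (Suc k)))\<^sup>2
          \<le> f u + b + (L - \<mu>) / 2 * (norm (u - y k))\<^sup>2"
      using proximal_gradient_inequality[OF assms(1,4,6,7,8,9,10,11) assms(16)[of k, unfolded assms(14)]]
      by blast
    define Fp where "Fp = f (x (Suc k)) + a"
    have Fp: "F (x (Suc k)) = ereal Fp"
      by (simp add: assms(12) a Fp_def)
    obtain b where b: "h u = ereal b"
      using Fu_le ninf[of u] unfolding assms(12) by (cases "h u") auto
    have Fu: "f u + b \<le> (1 - q) * Fx + q * Fs - m / 2 * (q * (1 - q) * (norm (x k - x_star))\<^sup>2)"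
      using Fu_le by (simp add: assms(12) b)

    have "u - x (Suc k) = q *\<^sub>R (x_star - z (Suc k))"
      unfolding u_def xz by (simp add: algebra_simps)
    then have "(L + \<rho>) * (norm (u - x (Suc k)))\<^sup>2 = m * (norm (z (Suc k) - x_star))\<^sup>2"
      by (simp add: power_mult_distrib norm_minus_commute flip: q2)
    moreover have "(L - \<mu>) * (norm (u - y k))\<^sup>2
        \<le> m * (1 - q) * ((norm (z k - x_star))\<^sup>2 + q * (norm (x k - x_star))\<^sup>2)"
    proof -
      have "L - \<mu> = (L + \<rho>) * (1 - q\<^sup>2)"
        using q2 by (simp add: algebra_simps m_def)
      then have "(L - \<mu>) * (norm (u - y k))\<^sup>2 = (L + \<rho>) * ((1 - q\<^sup>2) * (norm (u - y k))\<^sup>2)"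
        by simp
      also have "\<dots> \<le> (L + \<rho>) * (q\<^sup>2 * (1 - q) * ((norm (z k - x_star))\<^sup>2 + q * (norm (x k - x_star))\<^sup>2))"
        unfolding u_def using extrapolation_distance_bound[OF q yz, of x_star] assms(1,4)
        by (intro mult_left_mono) auto
      also have "\<dots> = m * (1 - q) * ((norm (z k - x_star))\<^sup>2 + q * (norm (x k - x_star))\<^sup>2)"
        by (simp flip: q2)
      finally show ?thesis .
    qed
    ultimately have "Fp - Fs + m / 2 * (norm (z (Suc k) - x_star))\<^sup>2
        \<le> (1 - q) * (Fx - Fs + m / 2 * (norm (z k - x_star))\<^sup>2)"
      using step[OF b] Fu unfolding Fp_def by (simp add: field_simps)
    then show ?thesis
      by (simp add: assms(19) Fs real Fp q_def m_def)
  qed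
qed

end
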